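(* Let $P$ be a building block polygon whose lattice points correspond to characters $\chi_0,\dots,\chi_n$ of $T=(\mathbb C^* )^2$. Let $X\subseteq\mathbb P^n$ be the projective toric surface given as the closure of the image of $p\mapsto[\chi_0(p):\dots:\chi_n(p)]$. Then there is no line $\ell\subseteq\mathbb P^n$ contained in $X$ that passes through the identity point $[1:\dots:1]$ of $T\subseteq X$.
   Context: - A polygon means a convex polygon in $\mathbb R^2$ with vertices in $\mathbb Z^2$. - A building block polygon is a polygon with exactly one interior lattice point and at most five lattice points. - The lattice point $(a,b)$ corresponds to the character $x^ay^b$. *)

theory Defs
  imports "HOL-Analysis.Analysis" "HOL-Library.Poly_Mapping"
begin

definition lattice_polygon :: "(real \<times> real) set \<Rightarrow> bool" where
  "lattice_polygon P \<longleftrightarrow> polytope P \<and> aff_dim P = 2 \<and>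
     (\<forall>v. v extreme_point_of P \<longrightarrow> fst v \<in> \<int> \<and> snd v \<in> \<int>)"

definition lattice_points :: "(real \<times> real) set \<Rightarrow> (int \<times> int) set" where
  "lattice_points S = {(a, b). (real_of_int a, real_of_int b) \<in> S}"

definition building_block_polygon :: "(real \<times> real) set \<Rightarrow> bool" where
  "building_block_polygon P \<longleftrightarrow> lattice_polygon P \<and>
     card (lattice_points (interior P)) = 1 \<and> card (lattice_points P) \<le> 5"

definition torus2 :: "(complex \<times> complex) set" where
  "torus2 = {(x, y). x \<noteq> 0 \<and> y \<noteq> 0}"

definition lattice_character :: "int \<times> int \<Rightarrow> complex \<times> complex \<Rightarrow> complex" where
  "lattice_character = (\<lambda>(a, b) (x, y). x powi a * y powi b)"

text \<open>Complex projective space with homogeneous coordinates indexed by a finite type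
  \<open>'i\<close>; its dimension is \<open>CARD('i) - 1\<close>.\<close>

definition proj_rel :: "complex ^ 'i::finite \<Rightarrow> complex ^ 'i \<Rightarrow> bool" where
  "proj_rel u v \<longleftrightarrow> u \<noteq> 0 \<and> v \<noteq> 0 \<and> (\<exists>c. c \<noteq> 0 \<and> v = c *s u)"

quotient_type 'i proj_space = "complex ^ 'i::finite" / partial: proj_rel
  morphisms rep_proj proj_pt
proof (rule part_equivpI)
  have "proj_rel (vec 1 :: complex ^ 'i) (vec 1)"
    unfolding proj_rel_def by (auto simp: vec_eq_iff intro!: exI[of _ 1])
  then show "\<exists>v :: complex ^ 'i. proj_rel v v" by blast
  show "symp (proj_rel :: complex ^ 'i \<Rightarrow> _)"
  proof (rule sympI)
    fix u v :: "complex ^ 'i"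
    assume "proj_rel u v"
    then obtain c where c: "u \<noteq> 0" "v \<noteq> 0" "c \<noteq> 0" "v = c *s u"
      unfolding proj_rel_def by blast
    then have "u = inverse c *s v" by (simp add: vec_eq_iff)
    with c show "proj_rel v u"
      unfolding proj_rel_def by (metis nonzero_imp_inverse_nonzero)
  qed
  show "transp (proj_rel :: complex ^ 'i \<Rightarrow> _)"
  proof (rule transpI)
    fix u v w :: "complex ^ 'i"
    assume "proj_rel u v" "proj_rel v w"
    then obtain c d where "u \<noteq> 0" "w \<noteq> 0" "c \<noteq> 0" "d \<noteq> 0" "v = c *s u" "w = d *s v"
      unfolding proj_rel_def by blast
    then have "w = (d * c) *s u" "d * c \<noteq> 0" by (simp_all add: vec_eq_iff)
    with \<open>u \<noteq> 0\<close> \<open>w \<noteq> 0\<close> show "proj_rel u w" unfolding proj_rel_def by blast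
  qed
qed

text \<open>A polynomial maps exponent vectors to coefficients.\<close>

type_synonym 'i mpolynomial = "('i \<Rightarrow>\<^sub>0 nat) \<Rightarrow>\<^sub>0 complex"

definition poly_eval :: "'i::finite mpolynomial \<Rightarrow> complex ^ 'i \<Rightarrow> complex" where
  "poly_eval f v =
     (\<Sum>e\<in>Poly_Mapping.keys f. Poly_Mapping.lookup f e * (\<Prod>i\<in>UNIV. (v $ i) ^ Poly_Mapping.lookup e i))"

definition homogeneous :: "'i::finite mpolynomial \<Rightarrow> bool" where
  "homogeneous f \<longleftrightarrow>
     (\<exists>d. \<forall>e\<in>Poly_Mapping.keys f. (\<Sum>i\<in>UNIV. Poly_Mapping.lookup e i) = d)"

definition proj_zero_locus :: "'i::finite mpolynomial set \<Rightarrow> 'i proj_space set" where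
  "proj_zero_locus F = proj_pt ` {v. v \<noteq> 0 \<and> (\<forall>f\<in>F. poly_eval f v = 0)}"

definition zariski_closed :: "'i::finite proj_space set \<Rightarrow> bool" where
  "zariski_closed Z \<longleftrightarrow> (\<exists>F. (\<forall>f\<in>F. homogeneous f) \<and> Z = proj_zero_locus F)"

definition proj_line :: "'i::finite proj_space set \<Rightarrow> bool" where
  "proj_line l \<longleftrightarrow> (\<exists>W. vec.subspace W \<and> vec.dim W = 2 \<and> l = proj_pt ` (W - {0}))"

definition projective_toric_variety ::
  "('i::finite \<Rightarrow> complex \<times> complex \<Rightarrow> complex) \<Rightarrow> 'i proj_space set" where
  "projective_toric_variety ch =
     zariski_closed hull ((\<lambda>p. proj_pt (\<chi> i. ch i p)) ` torus2)"

end

theory Submission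
  imports Defs
begin

text \<open>Let \<open>p\<close> be the interior lattice point and \<open>q\<close> any lattice point of the polygon. Extending
  the segment from \<open>q\<close> to \<open>p\<close> slightly beyond \<open>p\<close> stays inside the polygon, so \<open>p\<close> is a convex
  combination of lattice points in which \<open>q\<close> has positive weight; the weights may be taken rational.
  Clearing denominators gives a homogeneous binomial \<open>x\<^sub>p\<^sup>N - x\<^sub>q\<^sup>a \<cdots>\<close> with \<open>a > 0\<close> that vanishes
  on \<open>X\<close>, so \<open>x\<^sub>q = 0\<close> forces \<open>x\<^sub>p = 0\<close> on \<open>X\<close>. If a plane \<open>W\<close> containing \<open>(1, \<dots>, 1)\<close> maps into
  \<open>X\<close>, apply this to \<open>v - v\<^sub>q (1, \<dots>, 1)\<close> for \<open>v \<in> W\<close> to get \<open>v\<^sub>p = v\<^sub>q\<close> for all \<open>q\<close>. Hence \<open>W\<close> is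
  spanned by \<open>(1, \<dots>, 1)\<close>, a contradiction.\<close>

section \<open>Simultaneous rational approximation of convex weights\<close>

text \<open>Carries \<open>Dirichlet_approx_simult\<close>, whose indices are natural numbers below
  a bound, over to an arbitrary finite index type along an enumeration \<open>h\<close>.\<close>

lemma Dirichlet_approx_simult_finite:
  fixes \<theta> :: "'i::finite \<Rightarrow> real" and M :: nat
  assumes "M > 0"
  obtains N :: nat and p :: "'i \<Rightarrow> int"
  where "N > 0" "\<And>i. \<bar>real N * \<theta> i - of_int (p i)\<bar> < 1 / M"
proof -
  obtain h where h: "bij_betw h (UNIV :: 'i set) {0..<CARD('i)}"
    using ex_bij_betw_finite_nat[OF finite_class.finite_UNIV] by blast
  obtain q p where qp: "0 < q"
    "\<And>k. k < CARD('i) \<Longrightarrow> \<bar>of_int q * \<theta> (inv h k) - of_int (p k)\<bar> < 1 / M"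
    using Dirichlet_approx_simult[OF assms, of "CARD('i)" "\<lambda>k. \<theta> (inv h k)"] by metis
  have "\<bar>real (nat q) * \<theta> i - of_int (p (h i))\<bar> < 1 / M" for i
  proof -
    have "h i < CARD('i)"
      using bij_betw_apply[OF h, of i] by simp
    moreover have "inv h (h i) = i"
      using h by (simp add: bij_betw_def)
    ultimately show ?thesis
      using qp(1) qp(2)[of "h i"] by simp
  qed
  then show thesis
    using qp(1) by (intro that[of "nat q" "\<lambda>i. p (h i)"]) auto
qed

text \<open>Both sides are integers, and their difference is a sum of rounding errors times
  \<open>a i\<close>, of absolute value at most
  \<open>(\<Sum>i\<in>UNIV. \<bar>a i\<bar>) / M < 1\<close>.\<close>

lemma approx_integer_combination:
  fixes \<theta> :: "'i::finite \<Rightarrow> real" and a p :: "'i \<Rightarrow> int" and c :: int and M N :: nat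
  assumes approx: "\<And>i. \<bar>real N * \<theta> i - of_int (p i)\<bar> < 1 / M"
    and M: "(\<Sum>i\<in>UNIV. \<bar>a i\<bar>) < int M"
    and comb: "(\<Sum>i\<in>UNIV. \<theta> i * of_int (a i)) = of_int c"
  shows "(\<Sum>i\<in>UNIV. p i * a i) = int N * c"
proof -
  have M0: "M > 0"
    using M sum_nonneg[of UNIV "\<lambda>i. \<bar>a i\<bar>"] by linarith
  have "real_of_int (int N * c - (\<Sum>i\<in>UNIV. p i * a i))
      = (\<Sum>i\<in>UNIV. (real N * \<theta> i - of_int (p i)) * of_int (a i))"
    by (simp add: comb[symmetric] sum_distrib_left sum_subtractf algebra_simps)
  also have "\<bar>\<dots>\<bar> \<le> (\<Sum>i\<in>UNIV. 1 / M * of_int \<bar>a i\<bar>)"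
  proof (rule order.trans[OF sum_abs], rule sum_mono)
    fix i
    show "\<bar>(real N * \<theta> i - of_int (p i)) * of_int (a i)\<bar> \<le> 1 / M * of_int \<bar>a i\<bar>"
      unfolding abs_mult of_int_abs using approx[of i] by (intro mult_right_mono) auto
  qed
  also have "\<dots> = of_int (\<Sum>i\<in>UNIV. \<bar>a i\<bar>) / M"
    by (simp add: sum_divide_distrib)
  also have "\<dots> < 1"
  proof -
    have "real_of_int (\<Sum>i\<in>UNIV. \<bar>a i\<bar>) < real M"
      using M by linarith
    then show ?thesis
      using M0 by simp
  qed
  finally show ?thesis
    by linarith
qed

text \<open>Scaling by a simultaneous Dirichlet approximation makes the weights so close to integers that
  rounding changes each integer-valued combination by less than 1, hence not at all.\<close>

lemma rational_convex_combination:
  fixes \<theta> :: "'i::finite \<Rightarrow> real" and a b :: "'i \<Rightarrow> int" and c d :: int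
  assumes nonneg: "\<And>i. \<theta> i \<ge> 0" and sum1: "(\<Sum>i\<in>UNIV. \<theta> i) = 1" and pos: "\<theta> q > 0"
    and combs: "(\<Sum>i\<in>UNIV. \<theta> i * of_int (a i)) = of_int c"
      "(\<Sum>i\<in>UNIV. \<theta> i * of_int (b i)) = of_int d"
  obtains N :: nat and n :: "'i \<Rightarrow> nat"
  where "N > 0" "n q > 0" "(\<Sum>i\<in>UNIV. n i) = N"
    "(\<Sum>i\<in>UNIV. int (n i) * a i) = int N * c" "(\<Sum>i\<in>UNIV. int (n i) * b i) = int N * d"
proof -
  obtain K :: nat where K: "K > 0" "1 / K < \<theta> q"
    using pos by (metis gr_zeroI inverse_eq_divide real_arch_inverse)
  \<comment> \<open>The summand \<open>K\<close> keeps the rounded weight at \<open>q\<close>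
    positive. Each other summand bounds one of the coefficient sums for \<open>1\<close>,
    \<open>a\<close> and \<open>b\<close>, strictly since \<open>K > 0\<close>.\<close>
  define M where "M = K + CARD('i) + nat (\<Sum>i\<in>UNIV. \<bar>a i\<bar>) + nat (\<Sum>i\<in>UNIV. \<bar>b i\<bar>)"
  have M: "M > 0" "M \<ge> K"
    using K(1) by (auto simp: M_def)
  have MK: "1 / real M \<le> 1 / K"
    using M(2) K(1) by (simp add: frac_le)
  obtain N p where N: "N > 0" and p: "\<And>i. \<bar>real N * \<theta> i - of_int (p i)\<bar> < 1 / M"
    using Dirichlet_approx_simult_finite[OF M(1), of \<theta>] by metis
  have p_nonneg: "p i \<ge> 0" for i
  proof -
    have "real N * \<theta> i \<ge> 0" "1 / real M \<le> 1"
      using nonneg[of i] M(1) by auto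
    then have "of_int (p i) > (-1 :: real)"
      using p[of i] by linarith
    then show ?thesis by linarith
  qed
  have "1 * \<theta> q \<le> real N * \<theta> q"
    using N nonneg[of q] by (intro mult_right_mono) auto
  then have "of_int (p q) > (0 :: real)"
    using p[of q] MK K(2) by linarith
  then have p_pos: "p q > 0" by simp
  have Ma: "(\<Sum>i\<in>UNIV. \<bar>a i\<bar>) < int M" and Mb: "(\<Sum>i\<in>UNIV. \<bar>b i\<bar>) < int M"
    and M1: "(\<Sum>i\<in>(UNIV :: 'i set). \<bar>1 :: int\<bar>) < int M"
    unfolding M_def
    using K(1) sum_nonneg[of UNIV "\<lambda>i. \<bar>a i\<bar>"] sum_nonneg[of UNIV "\<lambda>i. \<bar>b i\<bar>"]
    by (simp_all only: abs_ge_zero abs_one sum_constant of_nat_add)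
  have "(\<Sum>i\<in>UNIV. p i * 1) = int N * 1"
    by (rule approx_integer_combination[OF p M1]) (simp add: sum1)
  then have "int (\<Sum>i\<in>UNIV. nat (p i)) = int N"
    using p_nonneg by simp
  then have s1: "(\<Sum>i\<in>UNIV. nat (p i)) = N"
    by (simp only: of_nat_eq_iff)
  show thesis
  proof (rule that[OF N, of "\<lambda>i. nat (p i)"])
    show "(\<Sum>i\<in>UNIV. int (nat (p i)) * a i) = int N * c"
      using approx_integer_combination[OF p Ma combs(1)] p_nonneg by simp
    show "(\<Sum>i\<in>UNIV. int (nat (p i)) * b i) = int N * d"
      using approx_integer_combination[OF p Mb combs(2)] p_nonneg by simp
  qed (use s1 p_pos in auto)
qed

section \<open>Lattice points and convex combinations\<close>

text \<open>By Krein-Milman a polytope is the hull of its extreme points, and here these are lattice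
  points.\<close>

lemma lattice_polygon_hull_lattice_points:
  assumes "lattice_polygon P"
  shows "P = convex hull ((\<lambda>(a, b). (real_of_int a, real_of_int b)) ` lattice_points P)"
proof
  let ?L = "(\<lambda>(a, b). (real_of_int a, real_of_int b)) ` lattice_points P"
  have poly: "polytope P" and ext: "\<And>v. v extreme_point_of P \<Longrightarrow> fst v \<in> \<int> \<and> snd v \<in> \<int>"
    using assms by (auto simp: lattice_polygon_def)
  have "{v. v extreme_point_of P} \<subseteq> ?L"
  proof clarify
    fix x y assume v: "(x, y) extreme_point_of P"
    then obtain a b where ab: "x = of_int a" "y = of_int b"
      using ext[OF v] by (auto elim!: Ints_cases)
    then have "(a, b) \<in> lattice_points P"
      using v by (auto simp: lattice_points_def extreme_point_of_def)
    then show "(x, y) \<in> ?L"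
      using ab by force
  qed
  moreover have "P = convex hull {v. v extreme_point_of P}"
    using poly Krein_Milman_polytope by (metis polytope_def)
  ultimately show "P \<subseteq> convex hull ?L"
    using hull_mono by metis
  show "convex hull ?L \<subseteq> P"
    by (rule hull_minimal) (auto simp: lattice_points_def poly polytope_imp_convex)
qed

lemma interior_point_convex_combination:
  fixes m :: "'i::finite \<Rightarrow> 'a::euclidean_space"
  assumes inj: "inj m" and P: "P = convex hull range m" and p: "p \<in> interior P"
  obtains \<theta> :: "'i \<Rightarrow> real"
  where "\<And>i. \<theta> i \<ge> 0" "(\<Sum>i\<in>UNIV. \<theta> i) = 1" "\<theta> q > 0" "(\<Sum>i\<in>UNIV. \<theta> i *\<^sub>R m i) = p"
proof -
  obtain e where e: "e > 0" "ball p e \<subseteq> P"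
    using p by (auto simp: mem_interior)
  \<comment> \<open>The displacement by \<open>\<epsilon> *\<^sub>R (p - m q)\<close> then has norm
    at most \<open>e / 2\<close>; the \<open>1\<close> in the denominator covers
    \<open>p = m q\<close>.\<close>
  define \<epsilon> where "\<epsilon> = e / (2 * (norm (p - m q) + 1))"
  have den: "norm (p - m q) + 1 > 0"
    by (simp add: add_nonneg_pos)
  have \<epsilon>: "\<epsilon> > 0"
    using e den by (simp add: \<epsilon>_def)
  have "\<epsilon> * norm (p - m q) \<le> \<epsilon> * (norm (p - m q) + 1)"
    using \<epsilon> by (intro mult_left_mono) auto
  also have "\<dots> = e / 2"
    using den by (simp add: \<epsilon>_def field_simps)
  also have "\<dots> < e"
    using e by simp
  finally have "p + \<epsilon> *\<^sub>R (p - m q) \<in> P"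
    using e \<epsilon> by (intro subsetD[OF e(2)]) (simp add: dist_norm)
  then obtain u where u: "\<And>x. x \<in> range m \<Longrightarrow> 0 \<le> u x" "sum u (range m) = 1"
      "(\<Sum>x\<in>range m. u x *\<^sub>R x) = p + \<epsilon> *\<^sub>R (p - m q)"
    unfolding P by (subst (asm) convex_hull_finite) auto
  have u1: "(\<Sum>i\<in>UNIV. u (m i)) = 1"
    using u(2) by (simp add: sum.reindex[OF inj])
  have u2: "(\<Sum>i\<in>UNIV. u (m i) *\<^sub>R m i) = p + \<epsilon> *\<^sub>R (p - m q)"
    using u(3) by (simp add: sum.reindex[OF inj])
  \<comment> \<open>Solving the representation of the shifted point for \<open>p\<close> adds
    \<epsilon> to the weight of \<open>q\<close> and divides all weights by
    \<open>1 + \<epsilon>\<close>.\<close>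
  define \<theta> where "\<theta> i = (u (m i) + (if i = q then \<epsilon> else 0)) / (1 + \<epsilon>)" for i
  have "(\<Sum>i\<in>UNIV. \<theta> i *\<^sub>R m i)
      = (1 / (1 + \<epsilon>)) *\<^sub>R (\<Sum>i\<in>UNIV. u (m i) *\<^sub>R m i + (if i = q then \<epsilon> *\<^sub>R m i else 0))"
    by (simp add: \<theta>_def scaleR_sum_right) (intro sum.cong, auto simp: algebra_simps add_divide_distrib)
  also have "\<dots> = (1 / (1 + \<epsilon>)) *\<^sub>R ((1 + \<epsilon>) *\<^sub>R p)"
    by (simp add: sum.distrib u2 algebra_simps)
  also have "\<dots> = p"
    using \<epsilon> by simp
  finally have comb: "(\<Sum>i\<in>UNIV. \<theta> i *\<^sub>R m i) = p" .
  show thesis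
  proof (rule that[OF _ _ _ comb])
    show "\<theta> i \<ge> 0" for i
      using \<epsilon> u(1)[of "m i"] by (simp add: \<theta>_def)
    show "\<theta> q > 0"
      using \<epsilon> u(1)[of "m q"] by (simp add: \<theta>_def add_nonneg_pos)
    show "(\<Sum>i\<in>UNIV. \<theta> i) = 1"
      using \<epsilon> by (simp add: \<theta>_def sum_divide_distrib[symmetric] sum.distrib u1)
  qed
qed

section \<open>Binomials vanishing on the toric variety\<close>

text \<open>The binomial \<open>x^a - x^b\<close>. Over a finite index type every exponent function
  has finite support, so \<open>Abs_poly_mapping\<close> loses nothing.\<close>

definition binomial_poly :: "('i \<Rightarrow> nat) \<Rightarrow> ('i \<Rightarrow> nat) \<Rightarrow> 'i::finite mpolynomial" where
  "binomial_poly a b = Poly_Mapping.single (Abs_poly_mapping a) 1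
    - Poly_Mapping.single (Abs_poly_mapping b) 1"

lemma keys_binomial_poly:
  "Poly_Mapping.keys (binomial_poly a b) \<subseteq> {Abs_poly_mapping a, Abs_poly_mapping b}"
  unfolding binomial_poly_def using keys_diff by fastforce

lemma lookup_exponent [simp]:
  fixes a :: "'i::finite \<Rightarrow> nat"
  shows "Poly_Mapping.lookup (Abs_poly_mapping a) = a"
  by (rule lookup_Abs_poly_mapping) simp

lemma poly_eval_binomial_poly:
  "poly_eval (binomial_poly a b) v = (\<Prod>i\<in>UNIV. (v $ i) ^ a i) - (\<Prod>i\<in>UNIV. (v $ i) ^ b i)"
proof -
  have "poly_eval (binomial_poly a b) v =
      (\<Sum>e\<in>{Abs_poly_mapping a, Abs_poly_mapping b}. Poly_Mapping.lookup (binomial_poly a b) e *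
        (\<Prod>i\<in>UNIV. (v $ i) ^ Poly_Mapping.lookup e i))"
    unfolding poly_eval_def
    by (rule sum.mono_neutral_left) (use keys_binomial_poly in \<open>auto simp: in_keys_iff\<close>)
  also have "\<dots> = (\<Prod>i\<in>UNIV. (v $ i) ^ a i) - (\<Prod>i\<in>UNIV. (v $ i) ^ b i)"
  \<comment> \<open>If \<open>a = b\<close>, the summation set collapses to one element and both
    sides are 0.\<close>
  proof (cases "a = b")
    case False
    then have "Abs_poly_mapping a \<noteq> Abs_poly_mapping b"
      by (metis lookup_exponent)
    then show ?thesis
      by (simp add: binomial_poly_def lookup_minus lookup_single)
  qed (simp add: binomial_poly_def)
  finally show ?thesis .
qed

lemma homogeneous_binomial_poly:
  assumes "sum a UNIV = sum b UNIV"
  shows "homogeneous (binomial_poly a b)"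
  unfolding homogeneous_def
  by (rule exI[of _ "sum a UNIV"]) (use assms keys_binomial_poly[of a b] in auto)

text \<open>The quotient is partial: equal classes give proportional vectors where
  \<open>proj_rel\<close> is reflexive, that is, for nonzero vectors.\<close>

lemma proj_pt_eqD:
  assumes "proj_pt u = proj_pt v" "u \<noteq> 0" "v \<noteq> 0"
  obtains c where "c \<noteq> 0" "v = c *s u"
proof -
  have refl: "proj_rel w w" if "w \<noteq> 0" for w :: "complex ^ 'a"
    using that by (auto simp: proj_rel_def intro!: exI[of _ 1])
  have "proj_rel u v"
    using Quotient3_rel[OF Quotient3_proj_space, of u v] refl assms by blast
  then show thesis
    using that by (auto simp: proj_rel_def)
qed

lemma prod_scaled_power:
  fixes v :: "complex ^ 'i::finite"
  shows "(\<Prod>i\<in>UNIV. ((c *s v) $ i) ^ a i) = c ^ sum a UNIV * (\<Prod>i\<in>UNIV. (v $ i) ^ a i)"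
  by (simp add: power_mult_distrib prod.distrib power_sum)

lemma prod_power_int_power:
  fixes x :: complex
  assumes "x \<noteq> 0" "finite A"
  shows "(\<Prod>i\<in>A. (x powi a i) ^ n i) = x powi (\<Sum>i\<in>A. int (n i) * a i)"
  using assms(2)
  by induction (use assms(1) in \<open>auto simp: power_int_add power_int_power' mult.commute\<close>)

lemma prod_lattice_character_power:
  fixes m :: "'i::finite \<Rightarrow> int \<times> int"
  assumes "t \<in> torus2"
  shows "(\<Prod>i\<in>UNIV. lattice_character (m i) t ^ n i)
    = lattice_character (\<Sum>i\<in>UNIV. int (n i) * fst (m i), \<Sum>i\<in>UNIV. int (n i) * snd (m i)) t"
  using assms
  by (cases t)
     (simp add: torus2_def lattice_character_def case_prod_beta power_mult_distrib prod.distrib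
        prod_power_int_power)

text \<open>Both monomials restrict to the same character of the torus, and equal degrees make the
  binomial homogeneous. Its zero locus is therefore closed and contains the torus image, hence also
  the closure.\<close>

lemma toric_binomial_relation:
  fixes m :: "'i::finite \<Rightarrow> int \<times> int" and a b :: "'i \<Rightarrow> nat"
  assumes deg: "sum a UNIV = sum b UNIV"
    and fst_eq: "(\<Sum>i\<in>UNIV. int (a i) * fst (m i)) = (\<Sum>i\<in>UNIV. int (b i) * fst (m i))"
    and snd_eq: "(\<Sum>i\<in>UNIV. int (a i) * snd (m i)) = (\<Sum>i\<in>UNIV. int (b i) * snd (m i))"
    and v: "v \<noteq> 0" "proj_pt v \<in> projective_toric_variety (\<lambda>i. lattice_character (m i))"
  shows "(\<Prod>i\<in>UNIV. (v $ i) ^ a i) = (\<Prod>i\<in>UNIV. (v $ i) ^ b i)"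
proof -
  let ?Z = "proj_zero_locus {binomial_poly a b}"
  have "projective_toric_variety (\<lambda>i. lattice_character (m i)) \<subseteq> ?Z"
    unfolding projective_toric_variety_def
  proof (rule hull_minimal)
    show "zariski_closed ?Z"
      unfolding zariski_closed_def using homogeneous_binomial_poly[OF deg] by blast
    show "(\<lambda>t. proj_pt (\<chi> i. lattice_character (m i) t)) ` torus2 \<subseteq> ?Z"
    proof clarify
      fix x y assume t: "(x, y) \<in> torus2"
      then have "(\<chi> i. lattice_character (m i) (x, y)) \<noteq> 0"
        by (auto simp: vec_eq_iff torus2_def lattice_character_def case_prod_beta)
      moreover have "poly_eval (binomial_poly a b) (\<chi> i. lattice_character (m i) (x, y)) = 0"
        by (simp add: poly_eval_binomial_poly prod_lattice_character_power[OF t] fst_eq snd_eq)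
      ultimately show "proj_pt (\<chi> i. lattice_character (m i) (x, y)) \<in> ?Z"
        unfolding proj_zero_locus_def by blast
    qed
  qed
  then obtain u where u: "u \<noteq> 0" "poly_eval (binomial_poly a b) u = 0" "proj_pt u = proj_pt v"
    using v(2) unfolding proj_zero_locus_def by fastforce
  \<comment> \<open>The binomial is known to vanish at some representative \<open>u\<close>; passing
    to \<open>v\<close> multiplies both monomials by the same power of \<open>c\<close>.\<close>
  obtain c where "v = c *s u"
    using proj_pt_eqD[OF u(3) u(1) v(1)] by blast
  then show ?thesis
    using u(2) deg by (simp only: poly_eval_binomial_poly prod_scaled_power) simp
qed

section \<open>Vanishing coordinates and lines through the identity\<close>

lemma toric_coordinate_zero:
  fixes m :: "'i::finite \<Rightarrow> int \<times> int"
  assumes P: "lattice_polygon P" and m: "bij_betw m UNIV (lattice_points P)"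
    and p: "m p \<in> lattice_points (interior P)"
    and v: "v \<noteq> 0" "proj_pt v \<in> projective_toric_variety (\<lambda>i. lattice_character (m i))"
    and vq: "v $ q = 0"
  shows "v $ p = 0"
proof -
  define r where "r = (\<lambda>(a, b). (real_of_int a, real_of_int b))"
  have "inj r"
    by (auto simp: r_def inj_def)
  then have inj: "inj (r \<circ> m)"
    using m by (intro inj_compose) (auto simp: bij_betw_def)
  have hull: "P = convex hull range (r \<circ> m)"
    using lattice_polygon_hull_lattice_points[OF P] bij_betw_imp_surj_on[OF m]
    by (simp only: r_def image_comp[symmetric])
  have "(r \<circ> m) p \<in> interior P"
    using p by (cases "m p") (simp add: r_def lattice_points_def)
  from interior_point_convex_combination[OF inj hull this, of q]
  obtain \<theta> where \<theta>: "\<And>i. \<theta> i \<ge> 0" "(\<Sum>i\<in>UNIV. \<theta> i) = 1" "\<theta> q > 0"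
      "(\<Sum>i\<in>UNIV. \<theta> i *\<^sub>R (r \<circ> m) i) = (r \<circ> m) p"
    by blast
  have "(\<Sum>i\<in>UNIV. \<theta> i * of_int (fst (m i))) = of_int (fst (m p))"
    "(\<Sum>i\<in>UNIV. \<theta> i * of_int (snd (m i))) = of_int (snd (m p))"
    using arg_cong[OF \<theta>(4), of fst] arg_cong[OF \<theta>(4), of snd]
    by (simp_all add: fst_sum snd_sum r_def case_prod_beta)
  from rational_convex_combination[OF \<theta>(1-3) this]
  obtain N n where N: "N > 0" "n q > 0" "(\<Sum>i\<in>UNIV. n i) = N"
    "(\<Sum>i\<in>UNIV. int (n i) * fst (m i)) = int N * fst (m p)"
    "(\<Sum>i\<in>UNIV. int (n i) * snd (m i)) = int N * snd (m p)"
    by blast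
  have single: "(\<Sum>i\<in>UNIV. int (if i = p then N else 0) * g i) = int N * g p" for g
    by (simp add: if_distrib[of int] if_distrib[of "\<lambda>x. x * _"] cong: if_cong)
  \<comment> \<open>The left side is the monomial \<open>x_p^N\<close>; the right one contains
    \<open>x_q\<close> with the positive exponent \<open>n q\<close>.\<close>
  have "(\<Prod>i\<in>UNIV. (v $ i) ^ (if i = p then N else 0)) = (\<Prod>i\<in>UNIV. (v $ i) ^ n i)"
    by (rule toric_binomial_relation[OF _ _ _ v]) (simp_all only: single N, simp)
  also have "\<dots> = 0"
    using vq N(2) by (intro prod_zero) auto
  finally show ?thesis
    using N(1) by (simp add: if_distrib[of "\<lambda>k. _ ^ k"] cong: if_cong)
qed

theorem theoremA6:
  fixes P :: "(real \<times> real) set"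
    and m :: "'i::finite \<Rightarrow> int \<times> int"
    and ch :: "'i \<Rightarrow> complex \<times> complex \<Rightarrow> complex"
    and X :: "'i proj_space set"
  assumes "building_block_polygon P"
    and "bij_betw m UNIV (lattice_points P)"
    and "\<And>i. ch i = lattice_character (m i)"
    and "X = projective_toric_variety ch"
  shows "\<not> (\<exists>l. proj_line l \<and> l \<subseteq> X \<and> proj_pt (\<chi> i. 1) \<in> l)"
proof
  let ?one = "(\<chi> i. 1) :: complex ^ 'i"
  assume "\<exists>l. proj_line l \<and> l \<subseteq> X \<and> proj_pt ?one \<in> l"
  then obtain W where W: "vec.subspace W" "vec.dim W = 2" "proj_pt ` (W - {0}) \<subseteq> X"
      "proj_pt ?one \<in> proj_pt ` (W - {0})"
    unfolding proj_line_def by blast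
  have X: "X = projective_toric_variety (\<lambda>i. lattice_character (m i))"
    using assms(3,4) by presburger
  have P: "lattice_polygon P" and "card (lattice_points (interior P)) = 1"
    using assms(1) by (auto simp: building_block_polygon_def)
  then obtain z where z: "z \<in> lattice_points (interior P)"
    by (metis card_1_singletonE singletonI)
  then have "z \<in> lattice_points P"
    using interior_subset by (auto simp: lattice_points_def)
  then obtain p where p: "m p \<in> lattice_points (interior P)"
    using assms(2) z by (metis bij_betw_imp_surj_on imageE)
  \<comment> \<open>The hypothesis only places the class of the all-ones vector on the line;
    rescaling a representative \<open>w\<close> puts the vector itself into
    \<open>W\<close>.\<close>
  obtain w where w: "w \<in> W" "w \<noteq> 0" "proj_pt w = proj_pt ?one"
    using W(4) by force
  have "?one \<noteq> 0"
    by (simp add: vec_eq_iff)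
  then obtain c where "?one = c *s w"
    using proj_pt_eqD[OF w(3,2)] by blast
  then have one: "?one \<in> W"
    using W(1) w(1) by (simp add: vec.subspace_scale)
  have "v $ p = v $ q" if "v \<in> W" for v q
  proof -
    let ?u = "v - (v $ q) *s ?one"
    have "?u \<in> W"
      using W(1) that one by (simp add: vec.subspace_diff vec.subspace_scale)
    \<comment> \<open>Coordinate \<open>q\<close> of \<open>?u\<close> is 0 by construction. The
      zero vector represents no projective point, so it is treated apart.\<close>
    moreover have "?u $ p = 0" if "?u \<in> W" "?u \<noteq> 0"
      by (rule toric_coordinate_zero[OF P assms(2) p, where q = q]) (use that W(3) X in auto)
    ultimately have "?u $ p = 0"
      by (metis zero_index)
    then show ?thesis by simp
  qed
  then have "v = (v $ p) *s ?one" if "v \<in> W" for v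
    unfolding vec_eq_iff using that by (metis mult.right_neutral vec_lambda_beta vector_smult_component)
  then have "W \<subseteq> vec.span {?one}"
    by (metis insertI1 subsetI vec.span_base vec.span_scale)
  then have "vec.dim W \<le> card {?one}"
    by (rule vec.dim_le_card) simp
  then show False
    using W(2) by simp
qed

end
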